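(* Let $0\le\rho\le2$, $L_0>0$, $L_1\ge0$, and let $f:\mathbb{R}^d\to\mathbb{R}\cup\{\infty\}$ be $(\rho,L_0,L_1)$-smooth, with $f(x)\ge f^*$ for all $x\in\mathcal{X}$ for some $f^*\in\mathbb{R}$. Let $x_0\in\mathcal{X}$, $\Delta:=f(x_0)-f^*$, $\ell(s)=L_0+L_1s^\rho$, and let $\{x_k\}_{k\ge0}$ be generated by $$x_{k+1}=x_k-\gamma_k\nabla f(x_k),\qquad \gamma_k=\int_0^1\frac{dv}{\ell(\|\nabla f(x_k)\|+\|\nabla f(x_k)\|v)}.$$ Then for every $\varepsilon>0$ and every integer $T\ge1$ with $$T\ge\max\left\{\frac{8L_0\Delta}{\varepsilon},\frac{32L_1\Delta}{\varepsilon^{(2-\rho)/2}}\right\}$$ one has $\min_{k\in\{0,\dots,T-1\}}\|\nabla f(x_k)\|^2\le\varepsilon$.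
   Context: Norms are Euclidean for vectors and spectral for matrices. For $f:\mathbb{R}^d\to\mathbb{R}\cup\{\infty\}$ put $\mathcal{X}=\{x\in\mathbb{R}^d: f(x)<\infty\}$, assumed to be open and convex. $f$ is $(\rho,L_0,L_1)$-smooth if $f$ is twice differentiable on $\mathcal{X}$, continuous on the closure of $\mathcal{X}$ (as a map into $\mathbb{R}\cup\{\infty\}$), and $\|\nabla^2f(x)\|\le L_0+L_1\|\nabla f(x)\|^\rho$ for all $x\in\mathcal{X}$. (The iteration is well defined: the iterates stay in $\mathcal{X}$.) *)

theory Defs
  imports "HOL-Analysis.Analysis"
begin

definition eff_domain :: "(real^'n \<Rightarrow> ereal) \<Rightarrow> (real^'n) set" where
  "eff_domain f = {x. f x < \<infinity>}"

text \<open>The finite part of an extended-valued function; derivatives are only meaningful on the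
  (open) effective domain, where it agrees with the function itself.\<close>

definition finite_part :: "(real^'n \<Rightarrow> ereal) \<Rightarrow> real^'n \<Rightarrow> real" where
  "finite_part f x = real_of_ereal (f x)"

definition grad :: "(real^'n \<Rightarrow> ereal) \<Rightarrow> real^'n \<Rightarrow> real^'n" where
  "grad f x = (THE g. GDERIV (finite_part f) x :> g)"

definition hessian :: "(real^'n \<Rightarrow> ereal) \<Rightarrow> real^'n \<Rightarrow> real^'n^'n" where
  "hessian f x = matrix (frechet_derivative (grad f) (at x))"

definition spectral_norm :: "real^'n^'m \<Rightarrow> real" where
  "spectral_norm A = onorm (\<lambda>v. A *v v)"

definition twice_differentiable_on :: "(real^'n \<Rightarrow> ereal) \<Rightarrow> (real^'n) set \<Rightarrow> bool" where
  "twice_differentiable_on f S \<longleftrightarrow>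
     (\<forall>x\<in>S. finite_part f differentiable (at x) \<and> grad f differentiable (at x))"

text \<open>The case distinction implements the convention that the zeroth power of 0 is 1; in the
  library, \<open>0 powr 0 = 0\<close>.\<close>

definition ell :: "real \<Rightarrow> real \<Rightarrow> real \<Rightarrow> real \<Rightarrow> real" where
  "ell \<rho> L0 L1 s = L0 + L1 * (if \<rho> = 0 then 1 else s powr \<rho>)"

definition generalized_smooth ::
    "real \<Rightarrow> real \<Rightarrow> real \<Rightarrow> (real^'n \<Rightarrow> ereal) \<Rightarrow> bool" where
  "generalized_smooth \<rho> L0 L1 f \<longleftrightarrow>
     twice_differentiable_on f (eff_domain f) \<and>
     continuous_on (closure (eff_domain f)) f \<and>
     (\<forall>x\<in>eff_domain f. spectral_norm (hessian f x) \<le> ell \<rho> L0 L1 (norm (grad f x)))"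

definition step_size ::
    "real \<Rightarrow> real \<Rightarrow> real \<Rightarrow> (real^'n \<Rightarrow> ereal) \<Rightarrow> real^'n \<Rightarrow> real" where
  "step_size \<rho> L0 L1 f x =
     integral {0..1} (\<lambda>v. 1 / ell \<rho> L0 L1 (norm (grad f x) + norm (grad f x) * v))"

end

theory Submission
  imports Defs
begin

text \<open>Fix an iterate \<open>y\<close> with gradient of norm \<open>G > 0\<close> and move along \<open>y - t \<nabla>f(y)\<close>. The relative
  gradient change \<open>E(t) = (\<nabla>f(y - t \<nabla>f(y)) - \<nabla>f(y)) / G\<close> starts at \<open>0\<close> and, by the smoothness
  condition and monotonicity of \<open>\<ell>\<close>, satisfies \<open>\<parallel>E'(t)\<parallel> \<le> \<ell>(G + G \<parallel>E(t)\<parallel>)\<close>. Separating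
  variables with \<open>q(v) = 1 / \<ell>(G + G v)\<close> and \<open>\<Phi>(w) = \<integral>\<^sub>0\<^sup>w q\<close> gives \<open>\<Phi>(\<parallel>E(t)\<parallel>) \<le> t\<close>
  (\<open>integral_norm_le_time\<close>). The step size is exactly \<open>\<gamma> = \<Phi>(1)\<close>, the time before which \<open>\<parallel>E\<parallel>\<close>
  cannot pass \<open>1\<close>; as \<open>q\<close> decreases, \<open>\<Phi>\<close> is concave, so even \<open>\<parallel>E(t)\<parallel> \<le> t / \<gamma>\<close> on
  \<open>[0, \<gamma>]\<close> (\<open>norm_le_linear_in_time\<close>). The slope of \<open>f\<close> along the path is therefore at most
  \<open>- G\<^sup>2 (1 - t / \<gamma>)\<close>, and integrating over the whole step gives a decrease of at least
  \<open>\<gamma> G\<^sup>2 / 2\<close>.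

  This argument needs the path to stay in the effective domain. It does, because \<open>f\<close> does not
  exceed \<open>f(y)\<close> on the part of the path inside the domain, whereas by continuity on the closure
  it would have to tend to \<open>\<infinity>\<close> at an exit point (\<open>gradient_step\<close>).

  Finally \<open>\<gamma> \<ge> 1 / \<ell>(2 G)\<close>. If \<open>G\<^sup>2 > \<epsilon>\<close> at each of the first \<open>T\<close> iterates, every step decreases
  \<open>f\<close> by more than \<open>1 / (2 B)\<close> with \<open>B = L\<^sub>0 / \<epsilon> + 4 L\<^sub>1 / \<epsilon> powr ((2 - \<rho>) / 2)\<close>
  (\<open>squared_over_ell_gt\<close>). The total decrease is at most \<open>\<Delta>\<close>, so \<open>T \<le> 2 B \<Delta>\<close>, while the
  hypothesis on \<open>T\<close> bounds each of the two summands of \<open>2 B \<Delta>\<close> by \<open>T / 4\<close>.\<close>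

section \<open>A comparison principle for norm growth\<close>

lemma integral_bounds_antimono:
  fixes q :: "real \<Rightarrow> real"
  assumes cont: "continuous_on {0..} q" and anti: "antimono_on {0..} q"
    and "0 \<le> a" "a \<le> b"
  shows "(b - a) * q b \<le> integral {a..b} q" and "integral {a..b} q \<le> (b - a) * q a"
proof -
  have "q integrable_on {a..b}"
    using cont \<open>0 \<le> a\<close> by (intro integrable_continuous_real) (rule continuous_on_subset, auto)
  moreover have "q b \<le> q v" "q v \<le> q a" if "v \<in> {a..b}" for v
    using monotone_onD[OF anti] that \<open>0 \<le> a\<close> by force+
  ultimately have "integral {a..b} (\<lambda>_. q b) \<le> integral {a..b} q"
    and "integral {a..b} q \<le> integral {a..b} (\<lambda>_. q a)"
    by (intro integral_le integrable_const_ivl; simp)+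
  then show "(b - a) * q b \<le> integral {a..b} q" "integral {a..b} q \<le> (b - a) * q a"
    using \<open>a \<le> b\<close> by auto
qed

lemma integral_split_at:
  fixes q :: "real \<Rightarrow> real"
  assumes cont: "continuous_on {0..} q" and "0 \<le> a" "a \<le> b"
  shows "integral {0..b} q = integral {0..a} q + integral {a..b} q"
proof -
  have "q integrable_on {0..b}"
    using cont by (intro integrable_continuous_real) (rule continuous_on_subset, auto)
  from Henstock_Kurzweil_Integration.integral_combine[OF assms(2,3) this] show ?thesis by simp
qed

text \<open>The primitive of a decreasing function is concave, hence lies above its chord over \<open>[0, 1]\<close>.
  The proof weighs the mean of \<open>q\<close> on \<open>[0, w]\<close>, which is at least \<open>q w\<close>, against its mean on
  \<open>[w, 1]\<close>, which is at most \<open>q w\<close>.\<close>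

lemma integral_antimono_ge_chord:
  fixes q :: "real \<Rightarrow> real"
  assumes cont: "continuous_on {0..} q" and anti: "antimono_on {0..} q"
    and "0 \<le> w" "w \<le> 1"
  shows "w * integral {0..1} q \<le> integral {0..w} q"
proof -
  have lo: "w * q w \<le> integral {0..w} q"
    using integral_bounds_antimono(1)[OF cont anti, of 0 w] assms by simp
  have "integral {0..1} q \<le> integral {0..w} q + (1 - w) * q w"
    using integral_split_at[OF cont assms(3,4)]
      integral_bounds_antimono(2)[OF cont anti assms(3,4)] by linarith
  then have "w * integral {0..1} q \<le> w * integral {0..w} q + (1 - w) * (w * q w)"
    using mult_left_mono[OF _ assms(3)] by (fastforce simp: algebra_simps)
  also have "\<dots> \<le> w * integral {0..w} q + (1 - w) * integral {0..w} q"
    using lo \<open>w \<le> 1\<close> by (intro add_left_mono mult_left_mono) auto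
  finally show ?thesis by (simp add: algebra_simps)
qed

text \<open>Separation of variables for the differential inequality \<open>\<parallel>E'\<parallel> \<le> 1 / q(\<parallel>E\<parallel>)\<close>. The norm is
  not differentiable at \<open>0\<close>, where the curve starts, so it is replaced by
  \<open>\<surd>(\<parallel>E\<parallel>\<^sup>2 + \<delta>\<^sup>2)\<close>, which grows no faster than \<open>\<parallel>E'\<parallel>\<close>; because this majorises \<open>\<parallel>E\<parallel>\<close> and
  \<open>q\<close> decreases, the inequality persists. The cost is the initial value \<open>\<delta>\<close>, which
  contributes at most \<open>\<delta> q(0)\<close>.\<close>

lemma integral_norm_le_time:
  fixes E E' :: "real \<Rightarrow> 'a::real_inner" and q :: "real \<Rightarrow> real"
  assumes cont: "continuous_on {0..} q" and anti: "antimono_on {0..} q"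
    and pos: "\<And>s. 0 \<le> s \<Longrightarrow> 0 < q s"
    and "0 \<le> \<tau>" and E0: "E 0 = 0"
    and deriv: "\<And>t. t \<in> {0..\<tau>} \<Longrightarrow> (E has_vector_derivative E' t) (at t)"
    and bound: "\<And>t. t \<in> {0..\<tau>} \<Longrightarrow> norm (E' t) * q (norm (E t)) \<le> 1"
  shows "integral {0..norm (E \<tau>)} q \<le> \<tau>"
proof (rule field_le_epsilon)
  fix e :: real assume "0 < e"
  define \<delta> where "\<delta> = e / q 0"
  have "\<delta> > 0" using \<open>0 < e\<close> pos[of 0] by (simp add: \<delta>_def)
  define N where "N t = sqrt (E t \<bullet> E t + \<delta>\<^sup>2)" for t
  have N_pos: "N t > 0" and N_ge: "N t \<ge> norm (E t)" for t
    using \<open>\<delta> > 0\<close> by (auto simp: N_def norm_eq_sqrt_inner intro!: add_nonneg_pos)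
  define \<Phi> where "\<Phi> w = integral {0..w} q" for w
  have \<Phi>_deriv: "(\<Phi> has_real_derivative q w) (at w)" if "w > 0" for w
  proof -
    have "continuous_on {0..w+1} q" by (rule continuous_on_subset[OF cont]) auto
    from integral_has_real_derivative[OF this, of w] that show ?thesis
      unfolding \<Phi>_def by (simp add: at_within_Icc_at)
  qed
  have N_deriv: "(N has_real_derivative (E t \<bullet> E' t) / N t) (at t)" if "t \<in> {0..\<tau>}" for t
  proof -
    have d: "(E has_derivative (\<lambda>h. h *\<^sub>R E' t)) (at t)"
      using deriv[OF that] by (simp add: has_vector_derivative_def)
    have "((\<lambda>t. E t \<bullet> E t + \<delta>\<^sup>2) has_real_derivative 2 * (E t \<bullet> E' t)) (at t)"
      unfolding has_field_derivative_def
      by (rule derivative_eq_intros d refl)+ (auto simp: inner_commute algebra_simps)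
    from DERIV_real_sqrt[THEN DERIV_chain2, OF _ this] show ?thesis
      using N_pos[of t] unfolding N_def by (simp add: field_simps)
  qed
  have "\<Phi> (N \<tau>) - \<tau> \<le> \<Phi> (N 0) - 0"
  proof (rule DERIV_nonpos_imp_nonincreasing[OF \<open>0 \<le> \<tau>\<close>])
    fix t assume t: "0 \<le> t" "t \<le> \<tau>"
    have "((\<lambda>t. \<Phi> (N t) - t) has_real_derivative q (N t) * ((E t \<bullet> E' t) / N t) - 1) (at t)"
      using DERIV_chain2[OF \<Phi>_deriv[OF N_pos] N_deriv] t
      by (intro DERIV_diff DERIV_ident) auto
    moreover have "q (N t) * ((E t \<bullet> E' t) / N t) \<le> 1"
    proof -
      have "E t \<bullet> E' t \<le> N t * norm (E' t)"
        using norm_cauchy_schwarz[of "E t" "E' t"] mult_right_mono[OF N_ge[of t], of "norm (E' t)"] by simp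
      then have "(E t \<bullet> E' t) / N t \<le> norm (E' t)"
        using N_pos[of t] by (simp add: field_simps)
      moreover have "q (N t) \<le> q (norm (E t))"
        using monotone_onD[OF anti, of "norm (E t)" "N t"] N_ge[of t] N_pos[of t] by simp
      ultimately have "q (N t) * ((E t \<bullet> E' t) / N t) \<le> q (norm (E t)) * norm (E' t)"
        using pos[of "N t"] N_pos[of t]
        by (meson less_imp_le mult_left_mono mult_right_mono norm_ge_zero order_trans)
      also have "\<dots> \<le> 1" using bound[of t] t by (simp add: mult.commute)
      finally show ?thesis .
    qed
    ultimately show "\<exists>y. ((\<lambda>t. \<Phi> (N t) - t) has_real_derivative y) (at t) \<and> y \<le> 0"
      by (intro exI conjI) auto
  qed
  moreover have "N 0 = \<delta>" using \<open>\<delta> > 0\<close> by (simp add: N_def E0)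
  moreover have "\<Phi> \<delta> \<le> e"
    using integral_bounds_antimono(2)[OF cont anti, of 0 \<delta>] \<open>\<delta> > 0\<close> pos[of 0]
    by (simp add: \<Phi>_def \<delta>_def)
  moreover have "\<Phi> (norm (E \<tau>)) \<le> \<Phi> (N \<tau>)"
  proof -
    have "0 \<le> (N \<tau> - norm (E \<tau>)) * q (N \<tau>)"
      using N_ge[of \<tau>] pos[of "N \<tau>"] N_pos[of \<tau>] by simp
    then show ?thesis
      using integral_bounds_antimono(1)[OF cont anti, of "norm (E \<tau>)" "N \<tau>"]
        integral_split_at[OF cont, of "norm (E \<tau>)" "N \<tau>"] N_ge[of \<tau>] by (simp add: \<Phi>_def)
  qed
  ultimately show "integral {0..norm (E \<tau>)} q \<le> \<tau> + e" by (simp add: \<Phi>_def)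
qed

text \<open>Up to the time \<open>\<integral>\<^sub>0\<^sup>1 q\<close> the norm stays within \<open>[0, 1]\<close>, where concavity of the primitive
  turns the implicit bound into a linear one. The linear bound is what produces the factor
  \<open>1/2\<close> in the descent estimate; \<open>\<parallel>E\<parallel> \<le> 1\<close> alone would give no decrease.\<close>

lemma norm_le_linear_in_time:
  fixes E E' :: "real \<Rightarrow> 'a::real_inner" and q :: "real \<Rightarrow> real"
  assumes cont: "continuous_on {0..} q" and anti: "antimono_on {0..} q"
    and pos: "\<And>s. 0 \<le> s \<Longrightarrow> 0 < q s"
    and "0 \<le> \<tau>" and \<tau>: "\<tau> \<le> integral {0..1} q" and E0: "E 0 = 0"
    and deriv: "\<And>t. t \<in> {0..\<tau>} \<Longrightarrow> (E has_vector_derivative E' t) (at t)"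
    and bound: "\<And>t. t \<in> {0..\<tau>} \<Longrightarrow> norm (E' t) * q (norm (E t)) \<le> 1"
  shows "norm (E \<tau>) * integral {0..1} q \<le> \<tau>"
proof -
  have le: "integral {0..norm (E \<tau>)} q \<le> \<tau>"
    by (rule integral_norm_le_time[OF cont anti pos \<open>0 \<le> \<tau>\<close> E0 deriv bound])
  have "norm (E \<tau>) \<le> 1"
  proof (rule ccontr)
    assume *: "\<not> norm (E \<tau>) \<le> 1"
    then have "0 < (norm (E \<tau>) - 1) * q (norm (E \<tau>))" using pos by simp
    with * le \<tau> show False
      using integral_bounds_antimono(1)[OF cont anti, of 1 "norm (E \<tau>)"]
        integral_split_at[OF cont, of 1 "norm (E \<tau>)"] by simp
  qed
  with integral_antimono_ge_chord[OF cont anti, of "norm (E \<tau>)"] le show ?thesis by simp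
qed

section \<open>The smoothness modulus and the step size\<close>

lemma ell_pos:
  assumes "L0 > 0" "L1 \<ge> 0"
  shows "0 < ell \<rho> L0 L1 s"
  using assms by (auto simp: ell_def intro!: add_pos_nonneg)

lemma ell_mono:
  assumes "0 \<le> \<rho>" "L1 \<ge> 0" "0 \<le> s" "s \<le> t"
  shows "ell \<rho> L0 L1 s \<le> ell \<rho> L0 L1 t"
  using assms by (auto simp: ell_def intro!: mult_left_mono powr_mono2)

lemma continuous_on_ell_ray:
  assumes "g > 0"
  shows "continuous_on {0..} (\<lambda>v. ell \<rho> L0 L1 (g + g * v))"
proof -
  have "g + g * v \<noteq> 0" if "v \<ge> 0" for v
    using assms that by (smt (verit) mult_nonneg_nonneg)
  then show ?thesis
    unfolding ell_def by (cases "\<rho> = 0") (auto intro!: continuous_intros)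
qed

lemma reciprocal_ell_ray:
  assumes "0 \<le> \<rho>" "L0 > 0" "L1 \<ge> 0" "g > 0"
  defines "q \<equiv> \<lambda>v. 1 / ell \<rho> L0 L1 (g + g * v)"
  shows "continuous_on {0..} q" "antimono_on {0..} q" "\<And>v. 0 < q v"
proof -
  show "0 < q v" for v using ell_pos[OF assms(2,3)] by (simp add: q_def)
  show "continuous_on {0..} q"
    unfolding q_def using continuous_on_ell_ray[OF assms(4)] ell_pos[OF assms(2,3)]
    by (intro continuous_intros) (auto simp: less_imp_neq[THEN not_sym])
  show "antimono_on {0..} q"
  proof (rule monotone_onI)
    fix v w :: real assume "v \<in> {0..}" "w \<in> {0..}" "v \<le> w"
    then have "ell \<rho> L0 L1 (g + g * v) \<le> ell \<rho> L0 L1 (g + g * w)"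
      using assms by (intro ell_mono) auto
    then show "q w \<le> q v"
      unfolding q_def using ell_pos[OF assms(2,3)] by (intro divide_left_mono) auto
  qed
qed

lemma step_size_ge:
  assumes "0 \<le> \<rho>" "L0 > 0" "L1 \<ge> 0" "norm (grad f y) > 0"
  shows "1 / ell \<rho> L0 L1 (2 * norm (grad f y)) \<le> step_size \<rho> L0 L1 f y"
  using integral_bounds_antimono(1)[OF reciprocal_ell_ray(1,2)[OF assms], of 0 1]
  by (simp add: step_size_def)

section \<open>Descent along the negative gradient\<close>

text \<open>The gradient is defined by a definite description, so the Riesz representative of the
  derivative must be shown to exist and to be unique.\<close>

lemma grad_GDERIV:
  assumes "finite_part f differentiable (at y)"
  shows "GDERIV (finite_part f) y :> grad f y"
proof -
  obtain D where D: "(finite_part f has_derivative D) (at y)"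
    using assms by (auto simp: differentiable_def)
  then interpret bounded_linear D by (rule has_derivative_bounded_linear)
  define g where "g = (\<Sum>i\<in>Basis. D i *\<^sub>R i)"
  have "D h = h \<bullet> g" for h
  proof -
    have "D h = D (\<Sum>i\<in>Basis. (h \<bullet> i) *\<^sub>R i)" by (simp add: euclidean_representation)
    also have "\<dots> = h \<bullet> g" by (simp add: g_def sum scaleR inner_sum_right mult.commute)
    finally show ?thesis .
  qed
  then have "D = (\<lambda>h. h \<bullet> g)" by auto
  with D have "GDERIV (finite_part f) y :> g" by (simp add: gderiv_def)
  moreover have "g' = g" if "GDERIV (finite_part f) y :> g'" for g'
  proof -
    have "(\<lambda>h. h \<bullet> g') = (\<lambda>h. h \<bullet> g)"
      using that calculation unfolding gderiv_def by (rule has_derivative_unique)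
    then show ?thesis by (metis inner_commute vector_eq_ldot)
  qed
  ultimately show ?thesis
    unfolding grad_def by (metis theI)
qed

lemma smooth_along_line:
  assumes "generalized_smooth \<rho> L0 L1 f" "y + t *\<^sub>R h \<in> eff_domain f"
  shows "((\<lambda>t. finite_part f (y + t *\<^sub>R h)) has_real_derivative grad f (y + t *\<^sub>R h) \<bullet> h) (at t)"
    and "((\<lambda>t. grad f (y + t *\<^sub>R h)) has_vector_derivative hessian f (y + t *\<^sub>R h) *v h) (at t)"
    and "norm (hessian f (y + t *\<^sub>R h) *v h) \<le> ell \<rho> L0 L1 (norm (grad f (y + t *\<^sub>R h))) * norm h"
proof -
  let ?z = "y + t *\<^sub>R h"
  have line: "((\<lambda>t. y + t *\<^sub>R h) has_derivative (\<lambda>s. s *\<^sub>R h)) (at t)"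
    by (auto intro!: derivative_eq_intros)
  have "(finite_part f has_derivative (\<lambda>v. v \<bullet> grad f ?z)) (at ?z)"
    using assms grad_GDERIV[of f ?z]
    by (auto simp: generalized_smooth_def twice_differentiable_on_def gderiv_def)
  from has_derivative_compose[OF line this]
  show "((\<lambda>t. finite_part f (y + t *\<^sub>R h)) has_real_derivative grad f ?z \<bullet> h) (at t)"
    by (simp add: has_field_derivative_def inner_commute mult_commute_abs)
  have diff: "grad f differentiable (at ?z)"
    using assms by (auto simp: generalized_smooth_def twice_differentiable_on_def)
  then have d: "(grad f has_derivative frechet_derivative (grad f) (at ?z)) (at ?z)"
    by (simp add: frechet_derivative_works)
  then have lin: "linear (frechet_derivative (grad f) (at ?z))"
    by (rule has_derivative_linear)
  have hess: "(*v) (hessian f ?z) = frechet_derivative (grad f) (at ?z)"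
    unfolding hessian_def by (rule ext) (simp add: matrix_works lin)
  show "((\<lambda>t. grad f (y + t *\<^sub>R h)) has_vector_derivative hessian f ?z *v h) (at t)"
    using has_derivative_compose[OF line d] lin
    by (simp add: has_vector_derivative_def hess linear_cmul)
  have "norm (hessian f ?z *v h) \<le> spectral_norm (hessian f ?z) * norm h"
    unfolding spectral_norm_def by (rule onorm) (rule matrix_vector_mul_bounded_linear)
  also have "\<dots> \<le> ell \<rho> L0 L1 (norm (grad f ?z)) * norm h"
    using assms by (intro mult_right_mono) (auto simp: generalized_smooth_def)
  finally show "norm (hessian f ?z *v h) \<le> ell \<rho> L0 L1 (norm (grad f ?z)) * norm h" .
qed

text \<open>The bound holds for every partial step \<open>\<tau>\<close>, not just the full one: that the correction
  term is nonnegative for all \<open>\<tau>\<close> up to the step size is what keeps the path inside the domain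
  in the next lemma.\<close>

lemma descent_inside_domain:
  fixes f :: "real^'n \<Rightarrow> ereal" and y :: "real^'n"
  defines "h \<equiv> - grad f y"
  assumes par: "0 \<le> \<rho>" "L0 > 0" "L1 \<ge> 0"
    and sm: "generalized_smooth \<rho> L0 L1 f"
    and g: "grad f y \<noteq> 0"
    and \<tau>: "0 \<le> \<tau>" "\<tau> \<le> step_size \<rho> L0 L1 f y"
    and dom: "\<And>t. t \<in> {0..\<tau>} \<Longrightarrow> y + t *\<^sub>R h \<in> eff_domain f"
  shows "finite_part f (y + \<tau> *\<^sub>R h)
    \<le> finite_part f y - (norm (grad f y))\<^sup>2 * (\<tau> - \<tau>\<^sup>2 / (2 * step_size \<rho> L0 L1 f y))"
proof -
  define G where "G = norm (grad f y)"
  have "G > 0" using g by (simp add: G_def)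
  define q where "q = (\<lambda>v. 1 / ell \<rho> L0 L1 (G + G * v))"
  have q: "continuous_on {0..} q" "antimono_on {0..} q" "0 < q v" for v
    unfolding q_def by (fact reciprocal_ell_ray[OF par \<open>G > 0\<close>])+
  define \<gamma> where "\<gamma> = integral {0..1} q"
  have \<gamma>: "step_size \<rho> L0 L1 f y = \<gamma>" by (simp add: step_size_def \<gamma>_def q_def G_def)
  have "q 1 \<le> \<gamma>" using integral_bounds_antimono(1)[OF q(1,2), of 0 1] by (simp add: \<gamma>_def)
  then have "\<gamma> > 0" using q(3)[of 1] by linarith
  define E where "E t = (1 / G) *\<^sub>R (grad f (y + t *\<^sub>R h) - grad f y)" for t
  define E' where "E' t = (1 / G) *\<^sub>R (hessian f (y + t *\<^sub>R h) *v h)" for t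
  have nh: "norm h = G" by (simp add: h_def G_def)
  have dE: "(E has_vector_derivative E' t) (at t)" if "t \<in> {0..\<tau>}" for t
    unfolding E_def E'_def
    by (rule derivative_eq_intros smooth_along_line(2)[OF sm dom[OF that]] refl | simp)+
  have bE: "norm (E' t) * q (norm (E t)) \<le> 1" if "t \<in> {0..\<tau>}" for t
  proof -
    have "grad f (y + t *\<^sub>R h) = grad f y + G *\<^sub>R E t" using \<open>G > 0\<close> by (simp add: E_def)
    then have "norm (grad f (y + t *\<^sub>R h)) \<le> G + G * norm (E t)"
      using norm_triangle_ineq[of "grad f y" "G *\<^sub>R E t"] \<open>G > 0\<close> by (simp add: G_def)
    then have "ell \<rho> L0 L1 (norm (grad f (y + t *\<^sub>R h))) \<le> ell \<rho> L0 L1 (G + G * norm (E t))"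
      using par by (intro ell_mono) auto
    moreover have "norm (E' t) \<le> ell \<rho> L0 L1 (norm (grad f (y + t *\<^sub>R h)))"
      using smooth_along_line(3)[OF sm dom[OF that]] \<open>G > 0\<close>
      by (simp add: E'_def nh field_simps)
    ultimately have "norm (E' t) \<le> ell \<rho> L0 L1 (G + G * norm (E t))" by linarith
    then show ?thesis
      using ell_pos[OF par(2,3)] by (simp add: q_def)
  qed
  have lin: "norm (E t) * \<gamma> \<le> t" if "t \<in> {0..\<tau>}" for t
    unfolding \<gamma>_def
  proof (rule norm_le_linear_in_time[OF q(1,2), where E' = E'])
    show "0 \<le> t" "t \<le> integral {0..1} q" using that \<tau> \<gamma> by (auto simp: \<gamma>_def)
    show "E 0 = 0" by (simp add: E_def)
  qed (use that in \<open>auto intro!: q(3) dE bE\<close>)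
  define P where "P t = finite_part f (y + t *\<^sub>R h) + G\<^sup>2 * (t - t\<^sup>2 / (2 * \<gamma>))" for t
  have "P \<tau> \<le> P 0"
  proof (rule DERIV_nonpos_imp_nonincreasing[OF \<tau>(1)])
    fix t assume t: "0 \<le> t" "t \<le> \<tau>"
    have "(P has_real_derivative grad f (y + t *\<^sub>R h) \<bullet> h + G\<^sup>2 * (1 - t / \<gamma>)) (at t)"
      unfolding P_def using \<open>\<gamma> > 0\<close> t
      by (auto intro!: derivative_eq_intros smooth_along_line(1)[OF sm dom])
    moreover have "grad f (y + t *\<^sub>R h) \<bullet> h + G\<^sup>2 * (1 - t / \<gamma>) \<le> 0"
    proof -
      have "grad f (y + t *\<^sub>R h) = grad f y + G *\<^sub>R E t" using \<open>G > 0\<close> by (simp add: E_def)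
      then have "grad f (y + t *\<^sub>R h) \<bullet> h = - G\<^sup>2 + G * (E t \<bullet> h)"
        by (simp add: inner_add_left h_def G_def power2_norm_eq_inner)
      moreover have "E t \<bullet> h \<le> norm (E t) * G"
        using norm_cauchy_schwarz[of "E t" h] nh by simp
      then have "G * (E t \<bullet> h) \<le> G\<^sup>2 * norm (E t)"
        using mult_left_mono[of _ _ G] \<open>G > 0\<close> by (fastforce simp: power2_eq_square algebra_simps)
      moreover have "norm (E t) \<le> t / \<gamma>"
        using lin[of t] t \<open>\<gamma> > 0\<close> by (simp add: field_simps)
      then have "G\<^sup>2 * norm (E t) \<le> G\<^sup>2 * (t / \<gamma>)" by (intro mult_left_mono) auto
      ultimately show ?thesis by (simp add: algebra_simps)
    qed
    ultimately show "\<exists>d. (P has_real_derivative d) (at t) \<and> d \<le> 0" by blast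
  qed
  then show ?thesis by (simp add: P_def \<gamma> G_def)
qed

text \<open>The set \<open>S\<close> of times at which the path is in the effective domain is open in \<open>[0, \<gamma>]\<close>. By
  the descent bound it is also the set of times at which the path lies in the closure of the
  domain with \<open>f \<le> f(y)\<close>, which is closed. Connectedness of \<open>[0, \<gamma>]\<close> leaves only
  \<open>S = [0, \<gamma>]\<close>. Convexity of the domain supplies the initial segment that the descent bound
  asks for.\<close>

lemma gradient_step:
  fixes f :: "real^'n \<Rightarrow> ereal" and y :: "real^'n" and \<rho> L0 L1 :: real
  defines "\<gamma> \<equiv> step_size \<rho> L0 L1 f y"
  assumes par: "0 \<le> \<rho>" "L0 > 0" "L1 \<ge> 0"
    and ninf: "\<And>z. f z \<noteq> -\<infinity>"
    and op: "open (eff_domain f)" and conv: "convex (eff_domain f)"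
    and sm: "generalized_smooth \<rho> L0 L1 f"
    and g: "grad f y \<noteq> 0"
    and y: "y \<in> eff_domain f"
  shows "y - \<gamma> *\<^sub>R grad f y \<in> eff_domain f"
    and "finite_part f (y - \<gamma> *\<^sub>R grad f y) \<le> finite_part f y - \<gamma> * (norm (grad f y))\<^sup>2 / 2"
proof -
  define h where "h = - grad f y"
  define c where "c t = y + t *\<^sub>R h" for t :: real
  have \<gamma>_pos: "\<gamma> > 0"
    using step_size_ge[OF par, of f y] ell_pos[OF par(2,3)] g
    unfolding \<gamma>_def by (smt (verit) zero_less_divide_1_iff zero_less_norm_iff)
  have fin: "f z = ereal (finite_part f z)" if "z \<in> eff_domain f" for z
    using that ninf[of z] by (cases "f z") (auto simp: eff_domain_def finite_part_def)
  have seg: "c s \<in> eff_domain f" if "c t \<in> eff_domain f" "s \<in> {0..t}" for s t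
  proof (cases "t = 0")
    case True with that show ?thesis by simp
  next
    case False
    have "(1 - s / t) *\<^sub>R y + (s / t) *\<^sub>R c t \<in> eff_domain f"
      using that False by (intro convexD[OF conv y]) auto
    moreover have "(1 - s / t) *\<^sub>R y + (s / t) *\<^sub>R c t = c s"
      using False by (simp add: c_def algebra_simps)
    ultimately show ?thesis by simp
  qed
  have desc: "finite_part f (c t) \<le> finite_part f y - (norm (grad f y))\<^sup>2 * (t - t\<^sup>2 / (2 * \<gamma>))"
    if "t \<in> {0..\<gamma>}" "c t \<in> eff_domain f" for t
    unfolding c_def h_def \<gamma>_def
    using that seg by (intro descent_inside_domain[OF par sm g]) (auto simp: \<gamma>_def c_def h_def)
  define S where "S = {t \<in> {0..\<gamma>}. c t \<in> eff_domain f}"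
  have contc: "continuous_on A c" for A unfolding c_def by (intro continuous_intros)
  have S_eq: "S = {t \<in> {0..\<gamma>}. c t \<in> {z \<in> closure (eff_domain f). f z \<le> f y}}"
  proof -
    have "f (c t) \<le> f y" if "t \<in> {0..\<gamma>}" "c t \<in> eff_domain f" for t
    proof -
      have "0 \<le> t * (2 * \<gamma> - t)" using that(1) by auto
      then have "0 \<le> (norm (grad f y))\<^sup>2 * (t - t\<^sup>2 / (2 * \<gamma>))"
        using \<gamma>_pos by (intro mult_nonneg_nonneg) (auto simp: field_simps power2_eq_square)
      then show ?thesis using desc[OF that] fin[OF that(2)] fin[OF y] by simp
    qed
    moreover have "c t \<in> eff_domain f" if "f (c t) \<le> f y" for t
      using that y by (auto simp: eff_domain_def)
    ultimately show ?thesis using closure_subset by (auto simp: S_def)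
  qed
  have "closed {z \<in> closure (eff_domain f). f z \<le> f y}"
  proof -
    have "closed (closure (eff_domain f) \<inter> f -` {..f y})"
      using sm by (intro continuous_closed_preimage) (auto simp: generalized_smooth_def)
    then show ?thesis by (simp add: vimage_def Int_def)
  qed
  from continuous_closedin_preimage[OF contc[of "{0..\<gamma>}"] this]
  have "closedin (top_of_set {0..\<gamma>}) S"
    by (simp add: S_eq vimage_def Int_def)
  moreover have "openin (top_of_set {0..\<gamma>}) S"
    using continuous_openin_preimage_gen[OF contc[of "{0..\<gamma>}"] op]
    by (simp add: S_def vimage_def Int_def)
  moreover have "0 \<in> S" using y \<gamma>_pos by (simp add: S_def c_def)
  ultimately have "S = {0..\<gamma>}"
    using connected_clopen[of "{0..\<gamma>}"] by auto
  then have "\<gamma> \<in> S" using \<gamma>_pos by simp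
  then have in_dom: "c \<gamma> \<in> eff_domain f" by (simp add: S_def)
  have c\<gamma>: "c \<gamma> = y - \<gamma> *\<^sub>R grad f y" by (simp add: c_def h_def)
  show "y - \<gamma> *\<^sub>R grad f y \<in> eff_domain f" using in_dom c\<gamma> by simp
  show "finite_part f (y - \<gamma> *\<^sub>R grad f y) \<le> finite_part f y - \<gamma> * (norm (grad f y))\<^sup>2 / 2"
    using desc[OF _ in_dom] \<gamma>_pos c\<gamma> by (simp add: field_simps power2_eq_square)
qed

section \<open>Iteration count\<close>

text \<open>Because \<open>\<rho> \<le> 2\<close>, the quotient \<open>\<ell>(2 G) / G\<^sup>2\<close> decreases in \<open>G\<close>, so it is controlled by its
  value at \<open>G\<^sup>2 = \<epsilon>\<close>. The factor \<open>4\<close> comes from \<open>2 powr \<rho> \<le> 4\<close>.\<close>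

lemma squared_over_ell_gt:
  fixes G \<epsilon> :: real
  assumes "0 \<le> \<rho>" "\<rho> \<le> 2" "L0 > 0" "L1 \<ge> 0" "\<epsilon> > 0" "G > 0" "\<epsilon> < G\<^sup>2"
  shows "1 / (L0 / \<epsilon> + 4 * L1 / \<epsilon> powr ((2 - \<rho>) / 2)) < G\<^sup>2 / ell \<rho> L0 L1 (2 * G)"
proof -
  define a where "a = \<epsilon> powr ((2 - \<rho>) / 2)"
  have "a > 0" using assms by (simp add: a_def)
  have sq: "(G\<^sup>2) powr (p / 2) = G powr p" for p
    using \<open>G > 0\<close> by (simp add: powr_powr flip: powr_numeral)
  have "a \<le> (G\<^sup>2) powr ((2 - \<rho>) / 2)"
    unfolding a_def using assms by (intro powr_mono2) auto
  then have "a \<le> G powr (2 - \<rho>)" by (simp only: sq)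
  have pr: "(if \<rho> = 0 then 1 else (2 * G) powr \<rho>) = 2 powr \<rho> * G powr \<rho>"
    using \<open>G > 0\<close> by (simp add: powr_mult)
  have "2 powr \<rho> \<le> 2 powr (2::real)" using assms by (intro powr_mono) auto
  then have "2 powr \<rho> * G powr \<rho> \<le> 4 * G powr \<rho>" by (intro mult_right_mono) auto
  moreover have "G powr \<rho> \<le> G\<^sup>2 / a"
  proof -
    have "a * G powr \<rho> \<le> G powr (2 - \<rho>) * G powr \<rho>"
      using \<open>a \<le> G powr (2 - \<rho>)\<close> by (intro mult_right_mono) auto
    also have "\<dots> = G\<^sup>2" using \<open>G > 0\<close> by (simp flip: powr_add)
    finally show ?thesis using \<open>a > 0\<close> by (simp add: field_simps)
  qed
  ultimately have "2 powr \<rho> * G powr \<rho> \<le> 4 * (G\<^sup>2 / a)" by linarith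
  then have "L1 * (2 powr \<rho> * G powr \<rho>) \<le> L1 * (4 * (G\<^sup>2 / a))"
    using \<open>L1 \<ge> 0\<close> by (rule mult_left_mono)
  moreover have "L0 < L0 / \<epsilon> * G\<^sup>2" using assms by (simp add: field_simps)
  ultimately have "ell \<rho> L0 L1 (2 * G) < (L0 / \<epsilon> + 4 * L1 / a) * G\<^sup>2"
    unfolding ell_def pr by (simp add: algebra_simps)
  moreover have "0 < L0 / \<epsilon> + 4 * L1 / a" using assms \<open>a > 0\<close> by (simp add: add_pos_nonneg)
  ultimately show ?thesis
    using ell_pos[OF assms(3,4)] by (simp add: a_def[symmetric] field_simps)
qed

theorem mainTheorem5:
  fixes f :: "real^'n \<Rightarrow> ereal"
    and x :: "nat \<Rightarrow> real^'n"
    and x0 :: "real^'n"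
    and \<rho> L0 L1 fstar \<Delta> :: real
  assumes "0 \<le> \<rho>" and "\<rho> \<le> 2" and "L0 > 0" and "L1 \<ge> 0"
    and "\<And>y. f y \<noteq> -\<infinity>"
    and "open (eff_domain f)" and "convex (eff_domain f)"
    and "generalized_smooth \<rho> L0 L1 f"
    and "\<And>y. y \<in> eff_domain f \<Longrightarrow> f y \<ge> ereal fstar"
    and "x0 \<in> eff_domain f"
    and "\<Delta> = finite_part f x0 - fstar"
    and "x 0 = x0"
    and "\<And>k. x (Suc k) = x k - step_size \<rho> L0 L1 f (x k) *\<^sub>R grad f (x k)"
  shows "\<forall>\<epsilon>>0. \<forall>T::nat. T \<ge> 1 \<and>
           real T \<ge> max (8 * L0 * \<Delta> / \<epsilon>) (32 * L1 * \<Delta> / \<epsilon> powr ((2 - \<rho>) / 2)) \<longrightarrow>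
           Min ((\<lambda>k. (norm (grad f (x k)))\<^sup>2) ` {0..T-1}) \<le> \<epsilon>"
proof (intro allI impI, elim conjE)
  fix \<epsilon> :: real and T :: nat
  assume \<epsilon>: "\<epsilon> > 0" and T: "T \<ge> 1"
    and large: "real T \<ge> max (8 * L0 * \<Delta> / \<epsilon>) (32 * L1 * \<Delta> / \<epsilon> powr ((2 - \<rho>) / 2))"
  show "Min ((\<lambda>k. (norm (grad f (x k)))\<^sup>2) ` {0..T-1}) \<le> \<epsilon>"
  proof (rule ccontr)
    assume "\<not> ?thesis"
    then have big: "\<epsilon> < (norm (grad f (x k)))\<^sup>2" if "k < T" for k
      using that T by (auto simp: not_le)
    define B where "B = L0 / \<epsilon> + 4 * L1 / \<epsilon> powr ((2 - \<rho>) / 2)"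
    have "B > 0" unfolding B_def using assms(3,4) \<epsilon> by (intro add_pos_nonneg) auto
    have step: "x (Suc k) \<in> eff_domain f \<and>
        finite_part f (x (Suc k)) < finite_part f (x k) - 1 / (2 * B)"
      if "k < T" "x k \<in> eff_domain f" for k
    proof -
      have nz: "grad f (x k) \<noteq> 0" using big[OF that(1)] \<epsilon> by auto
      note gs = gradient_step[OF assms(1,3-8) nz that(2), folded assms(13)]
      define G where "G = norm (grad f (x k))"
      have "G > 0" using nz by (simp add: G_def)
      have "1 / B < G\<^sup>2 / ell \<rho> L0 L1 (2 * G)"
        unfolding B_def using big[OF that(1)] \<open>G > 0\<close> \<epsilon> assms(1-4)
        by (intro squared_over_ell_gt) (auto simp: G_def)
      also have "\<dots> \<le> step_size \<rho> L0 L1 f (x k) * G\<^sup>2"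
        using mult_right_mono[OF step_size_ge[OF assms(1,3,4), of f "x k"], of "G\<^sup>2"] nz
        by (simp add: G_def)
      finally show ?thesis using gs by (simp add: G_def field_simps)
    qed
    have tele: "x k \<in> eff_domain f \<and> finite_part f (x k) \<le> finite_part f x0 - k * (1 / (2 * B))"
      if "k \<le> T" for k
      using that
    proof (induction k)
      case 0 then show ?case using assms(10,12) by simp
    next
      case (Suc k)
      then show ?case using step[of k] by (simp add: algebra_simps add_divide_distrib)
    qed
    have "fstar \<le> finite_part f (x T)"
      using assms(9)[of "x T"] assms(5)[of "x T"] tele[of T]
      by (cases "f (x T)") (auto simp: finite_part_def eff_domain_def)
    with tele[of T] have "T / (2 * B) \<le> \<Delta>" using assms(11) by simp
    then have "T \<le> 2 * B * \<Delta>" using \<open>B > 0\<close> by (simp add: field_simps)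
    also have "\<dots> = (8 * L0 * \<Delta> / \<epsilon>) / 4 + (32 * L1 * \<Delta> / \<epsilon> powr ((2 - \<rho>) / 2)) / 4"
      by (simp add: B_def algebra_simps)
    also have "\<dots> \<le> T / 2" using large by simp
    finally show False using T by simp
  qed
qed

end
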